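(* For every integer $n>0$, $$\langle W|(yD+E)^{n-1}|V\rangle=\frac{1}{y(1-q)^n}\sum_{k=0}^n(-1)^k\left(\sum_{j=0}^{n-k}y^j\left(\binom{n}{j}\binom{n}{j+k}-\binom{n}{j-1}\binom{n}{j+k+1}\right)\right)\left(\sum_{i=0}^k y^i q^{i(k+1-i)}\right).$$
   Context: Let $q,y$ be commuting indeterminates (scalars). Let $D,E$ be operators, $\langle W|$ a row vector and $|V\rangle$ a column vector such that $DE-qED=D+E$, $\langle W|E=\langle W|$, $D|V\rangle=|V\rangle$ and $\langle W|\,|V\rangle=1$. For each $m\ge 0$, using $DE=qED+D+E$, one can uniquely write $(yD+E)^m=\sum_{i,j\ge0}n_{i,j}E^iD^j$ (normal form) with $n_{i,j}\in\mathbb{Z}[q,y]$, and $\langle W|(yD+E)^m|V\rangle=\sum_{i,j\geq 0} n_{i,j}$, which is a polynomial in $\mathbb{Z}[q,y]$. Binomial coefficients $\binom{a}{b}$ with $b<0$ or $b>a$ are zero. *)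

theory Defs
  imports "HOL-Computational_Algebra.Computational_Algebra"
begin

text \<open>
  The scalars are the rational functions in two indeterminates, that is, the fraction field of
  $\mathbf{Z}[q][y]$; the inner polynomial variable is $q$, the outer one is $y$.
\<close>

type_synonym scalar = "int poly poly fract"

definition q_ind :: scalar where
  "q_ind = Fract [:[:0, 1:]:] 1"

definition y_ind :: scalar where
  "y_ind = Fract [:0, 1:] 1"

text \<open>
  The lower index is an integer because it takes the value $-1$; with truncated subtraction
  the library's \<open>choose\<close> would give $1$ instead of $0$ there.
\<close>

definition binom :: "nat \<Rightarrow> int \<Rightarrow> int" where
  "binom a b = (if b < 0 then 0 else int (a choose nat b))"

text \<open>
  Operators are linear endomorphisms of a vector space over the scalars, the row vector is a
  linear functional \<open>W\<close> on it, and the column vector is an element \<open>V\<close> of it.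
\<close>

locale matrix_ansatz =
  D: Vector_Spaces.linear scale scale D +
  E: Vector_Spaces.linear scale scale E +
  W: Vector_Spaces.linear scale "(*)" W
  for scale :: "scalar \<Rightarrow> 'v::ab_group_add \<Rightarrow> 'v" and D E :: "'v \<Rightarrow> 'v"
    and W :: "'v \<Rightarrow> scalar" and V :: 'v +
  assumes commutation: "D (E v) - scale q_ind (E (D v)) = D v + E v"
    and W_E: "W (E v) = W v"
    and D_V: "D V = V"
    and W_V: "W V = 1"

text \<open>
  The axioms are satisfiable: on polynomials in $x$ over the scalars, let $(1-q)E-1$ be
  multiplication by $x$, let $(1-q)D-1$ send $x^m$ to $-q^{m+1}x^m+(1-q^m)x^{m-1}$, let $V$ be
  the constant $1$ and let $W$ be evaluation at $-q$.
\<close>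

definition D_model :: "scalar poly \<Rightarrow> scalar poly" where
  "D_model f = smult (1 / (1 - q_ind))
     (f + Abs_poly (\<lambda>m. (1 - q_ind ^ Suc m) * coeff f (Suc m) - q_ind ^ Suc m * coeff f m))"

definition E_model :: "scalar poly \<Rightarrow> scalar poly" where
  "E_model f = smult (1 / (1 - q_ind)) ([:1, 1:] * f)"

lemma q_ind_neq_1: "q_ind \<noteq> 1"
  by (simp add: q_ind_def One_fract_def eq_fract one_pCons)

lemma coeff_D_model:
  "coeff (D_model f) m = 1 / (1 - q_ind) *
     (coeff f m + ((1 - q_ind ^ Suc m) * coeff f (Suc m) - q_ind ^ Suc m * coeff f m))"
proof -
  let ?g = "\<lambda>m. (1 - q_ind ^ Suc m) * coeff f (Suc m) - q_ind ^ Suc m * coeff f m"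
  have "coeff (Abs_poly ?g) = ?g"
    by (rule coeff_Abs_poly[of "degree f"]) (simp add: coeff_eq_0)
  then show ?thesis
    by (simp add: D_model_def)
qed

lemma coeff_E_model:
  "coeff (E_model f) m = 1 / (1 - q_ind) * (coeff f m + (if m = 0 then 0 else coeff f (m - 1)))"
  by (cases m) (simp_all add: E_model_def)

lemma vector_space_smult: "vector_space (smult :: 'a::field \<Rightarrow> 'a poly \<Rightarrow> 'a poly)"
  by unfold_locales (simp_all add: smult_add_right smult_add_left)

lemma vector_space_times: "vector_space ((*) :: 'a::field \<Rightarrow> 'a \<Rightarrow> 'a)"
  by unfold_locales (simp_all add: algebra_simps)

lemma model_identity:
  fixes c q r a b d :: "'a::field"
  assumes "c * (1 - q) = 1"
  shows "c * (c * (b + a) + ((1 - q * r) * (c * (d + b)) - q * r * (c * (b + a))))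
      - q * (c * (c * (b + ((1 - q * r) * d - q * r * b)) + c * (a + ((1 - r) * b - r * a))))
    = c * (b + ((1 - q * r) * d - q * r * b)) + c * (b + a)"
  using assms by algebra

lemma matrix_ansatz_model:
  "matrix_ansatz smult D_model E_model (\<lambda>f. poly f (- q_ind)) 1"
proof -
  have nz: "1 - q_ind \<noteq> 0"
    using q_ind_neq_1 by simp
  have D: "Vector_Spaces.linear smult smult D_model"
    unfolding Vector_Spaces.linear_def module_hom_def module_hom_axioms_def module_iff_vector_space
    by (auto intro!: vector_space_smult poly_eqI simp: coeff_D_model algebra_simps)
  have E: "Vector_Spaces.linear smult smult E_model"
    unfolding Vector_Spaces.linear_def module_hom_def module_hom_axioms_def module_iff_vector_space
    by (auto intro!: vector_space_smult poly_eqI simp: coeff_E_model algebra_simps add_divide_distrib)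
  have W: "Vector_Spaces.linear smult (*) (\<lambda>f. poly f (- q_ind))"
    unfolding Vector_Spaces.linear_def module_hom_def module_hom_axioms_def module_iff_vector_space
    by (auto intro!: vector_space_smult vector_space_times)
  have comm: "D_model (E_model f) - smult q_ind (E_model (D_model f)) = D_model f + E_model f" for f
  proof (rule poly_eqI)
    fix m
    define c where "c = 1 / (1 - q_ind)"
    have c: "c * (1 - q_ind) = 1"
      using nz by (simp add: c_def)
    show "coeff (D_model (E_model f) - smult q_ind (E_model (D_model f))) m
        = coeff (D_model f + E_model f) m"
    proof (cases m)
      case 0
      then show ?thesis
        using model_identity[OF c, of "coeff f 0" 0 1 "coeff f 1"]
        by (simp add: coeff_D_model coeff_E_model flip: c_def)
    next
      case (Suc k)
      then show ?thesis
        using model_identity[OF c, of "coeff f m" "coeff f k" "q_ind ^ m" "coeff f (Suc m)"]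
        by (simp add: coeff_D_model coeff_E_model flip: c_def)
    qed
  qed
  have "poly (E_model f) (- q_ind) = poly f (- q_ind)" for f
    using nz by (simp add: E_model_def divide_simps) (simp add: algebra_simps)
  moreover have "D_model 1 = 1"
    using nz by (intro poly_eqI) (auto simp: coeff_D_model coeff_1 divide_simps)
  ultimately show ?thesis
    using D E W comm by (simp add: matrix_ansatz_def matrix_ansatz_axioms_def)
qed

end

theory Submission imports Defs begin

text \<open>
  Put $e_0 = V$ and $e_{b+1} = (1-q) E e_b - (1-q^b) e_b$. In this family $D$ lowers and $E$ raises
  the index by at most one, so that $(1-q)(yD+E)$ is tridiagonal (lemma \<open>step_basis\<close>):
  \[ (1-q)(yD+E)\, e_b = e_{b+1} + (1 + y - (1+yq)q^b)\, e_b + y(1-q^b)^2\, e_{b-1}. \]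
  Let $J$ be the induced operator on sequences $f(b) = \varphi(e_b)$ attached to linear functionals
  $\varphi$; then $(1-q)^m \, W (yD+E)^m V$ is the value at $0$ of $J^m$ applied to
  $b \mapsto W e_b$.

  This start sequence is itself in the image of $J$: if $\delta$ is the sequence $1, 0, 0, \dots$,
  then $J\delta = y(1-q)\, W e_b$ (lemma \<open>jacobi_delta\<close>). Here $\delta$ stands for a functional
  $W'$ with $W'E = 0$ and $W'V = 1$; by the commutation relation $(W'D)E = W'D$, so that $W'D$
  behaves like $W$ and $W'(yD+E) = yW$. This is where the exponent $n$ and the denominator $y$ come
  from: $y(1-q)^n \, W (yD+E)^{n-1} V = (J^n\delta)(0)$.

  To evaluate the right-hand side, write $J = X + (1+y)$ and let $U_0 = 1$,
  $U_{k+1} = X U_k - y U_{k-1}$ be the rescaled Chebyshev polynomials of $X$. Multiplication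
  by $X + (1+y)$ in the basis $U_k$ is a nearest-neighbour walk on the nonnegative integers, so that
  $J^n = \sum_k B(n,k) U_k$, where $B(n,k)$ counts weighted Motzkin paths. The reflection principle
  gives $B(n,k)$ as the difference of products of binomial coefficients in the theorem (lemma
  \<open>ballot_Suc\<close>). Finally $U_k\delta$ has a closed form, a sum of products of powers of $q$ and
  factors $1-q^i$ (lemma \<open>jacobi_cheb\<close>), and its value at $0$ is
  $(-1)^k \sum_{i=0}^k y^i q^{i(k+1-i)}$.
\<close>

section \<open>Weighted ballot numbers\<close>

text \<open>
  The first product is the coefficient of $y^j$ in the coefficient of $x^k$ of
  $(1+x)^n (1+y/x)^n$, which counts all walks ending at $k$; the second one removes, by reflection,
  the walks that reach $-1$. The lower arguments are integers so that the recurrence needs no case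
  distinction at $j = 0$ and $k = 0$.
\<close>

definition ballot_coeff :: "nat \<Rightarrow> int \<Rightarrow> int \<Rightarrow> int" where
  "ballot_coeff n j k = binom n j * binom n (j + k) - binom n (j - 1) * binom n (j + k + 1)"

text \<open>
  The weight of all paths of $n$ steps from $0$ to $k$ that stay nonnegative, with weight $1$ for a
  step up, $1+y$ for a level step and $y$ for a step down.
\<close>

definition ballot :: "'a::comm_ring_1 \<Rightarrow> nat \<Rightarrow> nat \<Rightarrow> 'a" where
  "ballot y n k = (\<Sum>j\<le>n - k. y ^ j * of_int (ballot_coeff n (int j) (int k)))"

lemma binom_Suc: "binom (Suc n) b = binom n b + binom n (b - 1)"
proof (cases "b \<le> 0")
  case True
  then show ?thesis by (auto simp: binom_def)
next
  case False
  then have "nat b = Suc (nat (b - 1))" by simp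
  then show ?thesis using False by (simp add: binom_def)
qed

lemma binom_eq_0: "b < 0 \<or> b > int n \<Longrightarrow> binom n b = 0"
  by (auto simp: binom_def)

text \<open>
  Pascal's rule in each of the factors of a product gives four products, which belong to the four
  kinds of last step: $1$, $y$ (level), up and down.
\<close>

lemma ballot_coeff_Suc:
  "ballot_coeff (Suc n) j k = ballot_coeff n j k + ballot_coeff n (j - 1) k
     + ballot_coeff n j (k - 1) + ballot_coeff n (j - 1) (k + 1)"
  by (simp add: ballot_coeff_def binom_Suc algebra_simps)

text \<open>The two reflected products cancel on the forbidden line: no admissible path ends at $-1$.\<close>

lemma ballot_coeff_minus_1_right: "ballot_coeff n j (- 1) = 0"
  by (simp add: ballot_coeff_def)

lemma ballot_coeff_minus_1_left: "ballot_coeff n (- 1) k = 0"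
  by (simp add: ballot_coeff_def binom_eq_0)

lemma ballot_coeff_beyond: "j + k > int n \<Longrightarrow> ballot_coeff n j k = 0"
  by (simp add: ballot_coeff_def binom_eq_0)

text \<open>
  A range of summation that does not depend on $k$ makes the sums for neighbouring heights
  comparable.
\<close>

lemma ballot_extend:
  assumes "n \<le> N"
  shows "ballot y n k = (\<Sum>j\<le>N. y ^ j * of_int (ballot_coeff n (int j) (int k)))"
  unfolding ballot_def
proof (intro sum.mono_neutral_left ballI)
  fix j
  assume "j \<in> {..N} - {..n - k}"
  then have "int j + int k > int n" by auto
  then show "y ^ j * of_int (ballot_coeff n (int j) (int k)) = 0"
    by (simp add: ballot_coeff_beyond)
qed (use assms in auto)

lemma ballot_beyond: "k > n \<Longrightarrow> ballot y n k = 0"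
  by (simp add: ballot_def ballot_coeff_beyond)

lemma ballot_0: "ballot y 0 k = (if k = 0 then 1 else 0)"
  by (cases "k = 0") (simp_all add: ballot_beyond, simp add: ballot_def ballot_coeff_def binom_def)

lemma ballot_Suc:
  "ballot y (Suc n) k = (1 + y) * ballot y n k
     + (if k = 0 then 0 else ballot y n (k - 1)) + y * ballot y n (Suc k)"
proof -
  define c where "c j l = (of_int (ballot_coeff n j l) :: 'a)" for j l
  have shift: "(\<Sum>j\<le>Suc n. y ^ j * c (int j - 1) l) = y * (\<Sum>j\<le>n. y ^ j * c (int j) l)" for l
    by (subst sum.atMost_Suc_shift)
       (simp add: c_def ballot_coeff_minus_1_left sum_distrib_left mult.assoc del: sum.atMost_Suc)
  have lower: "(\<Sum>j\<le>Suc n. y ^ j * c (int j) (int k - 1))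
      = (if k = 0 then 0 else ballot y n (k - 1))"
    by (simp add: c_def ballot_coeff_minus_1_right ballot_extend[of n "Suc n"] of_nat_diff
        del: sum.atMost_Suc)
  have "ballot y (Suc n) k
      = (\<Sum>j\<le>Suc n. y ^ j * of_int (ballot_coeff (Suc n) (int j) (int k)))"
    by (simp add: ballot_extend del: sum.atMost_Suc)
  also have "\<dots> = (\<Sum>j\<le>Suc n. y ^ j * c (int j) (int k))
      + (\<Sum>j\<le>Suc n. y ^ j * c (int j - 1) (int k))
      + (\<Sum>j\<le>Suc n. y ^ j * c (int j) (int k - 1))
      + (\<Sum>j\<le>Suc n. y ^ j * c (int j - 1) (int (Suc k)))"
    by (simp add: ballot_coeff_Suc c_def sum.distrib[symmetric] distrib_left add.commute[of _ 1]
        del: sum.atMost_Suc)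
  also have "\<dots> = ballot y n k + y * ballot y n k
      + (if k = 0 then 0 else ballot y n (k - 1)) + y * ballot y n (Suc k)"
    unfolding shift lower
    unfolding c_def ballot_extend[OF order.refl, symmetric]
      ballot_extend[OF le_SucI, OF order.refl, symmetric] by simp
  finally show ?thesis by (simp add: algebra_simps)
qed

section \<open>Chebyshev polynomials of the tridiagonal operator\<close>

text \<open>
  At $b = 0$ the truncated index \<open>b - 1\<close> does no harm, since its coefficient contains
  $1 - q^0 = 0$.
\<close>

definition jacobi :: "'a::comm_ring_1 \<Rightarrow> 'a \<Rightarrow> (nat \<Rightarrow> 'a) \<Rightarrow> nat \<Rightarrow> 'a" where
  "jacobi q y f b = f (Suc b) + (1 + y - (1 + y * q) * q ^ b) * f b
     + y * (1 - q ^ b)\<^sup>2 * f (b - 1)"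

lemma jacobi_sum:
  "jacobi q y (\<lambda>b. \<Sum>k\<in>K. c k * f k b) b = (\<Sum>k\<in>K. c k * jacobi q y (f k) b)"
  by (simp add: jacobi_def sum_distrib_left sum.distrib[symmetric] algebra_simps)

lemma jacobi_scale: "jacobi q y (\<lambda>b. c * f b) = (\<lambda>b. c * jacobi q y f b)"
  by (simp add: jacobi_def fun_eq_iff algebra_simps)

lemma jacobi_power_scale:
  "(jacobi q y ^^ n) (\<lambda>b. c * f b) = (\<lambda>b. c * (jacobi q y ^^ n) f b)"
  by (induction n) (simp_all add: jacobi_scale)

text \<open>
  The sequence $U_k\delta$ is $(-1)^k \sum_{a+d=k+1,\ d\ge1} y^a w(a,d)$ with weights $w(a,d)$ that
  depend on the position $b$. Solving the recurrence of $U_k\delta$ for the value at $b+1$ shows that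
  each increase of $b$ contributes one factor $1-q^{a-b}$ and one factor $1-q^{d+b}$, starting from
  $q^{ad}$ at $b = 0$. The truncated $a - b$ is harmless, because the product vanishes for $a < b$.
  The value $0$ at $d = 0$ differs from the formula only at $b = 0$; it allows sums to run up to
  $a = k+1$.
\<close>

definition cheb_weight :: "'a::comm_ring_1 \<Rightarrow> nat \<Rightarrow> nat \<Rightarrow> nat \<Rightarrow> 'a" where
  "cheb_weight q b a d = (if d = 0 then 0 else
     (- 1) ^ b * q ^ ((a - b) * d) * (\<Prod>j<b. (1 - q ^ (a - j)) * (1 - q ^ (d + j))))"

text \<open>The sequence $U_k\delta$, where $X = J - (1+y)$.\<close>

definition cheb :: "'a::comm_ring_1 \<Rightarrow> 'a \<Rightarrow> nat \<Rightarrow> nat \<Rightarrow> 'a" where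
  "cheb q y k b = (- 1) ^ k * (\<Sum>a\<le>k. y ^ a * cheb_weight q b a (Suc k - a))"

lemma cheb_weight_small:
  assumes "a < b"
  shows "cheb_weight q b a d = 0"
proof -
  have "(\<Prod>j<b. (1 - q ^ (a - j)) * (1 - q ^ (d + j))) = 0"
    using assms by (intro prod_zero bexI[of _ a]) auto
  then show ?thesis by (simp add: cheb_weight_def)
qed

lemma cheb_weight_positive_index:
  assumes "b > 0"
  shows "cheb_weight q b a d =
     (- 1) ^ b * q ^ ((a - b) * d) * ((\<Prod>j<b. 1 - q ^ (a - j)) * (\<Prod>j<b. 1 - q ^ (d + j)))"
proof -
  have "d = 0 \<Longrightarrow> (\<Prod>j<b. 1 - q ^ (d + j)) = 0"
    using assms by (intro prod_zero bexI[of _ 0]) auto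
  then show ?thesis by (auto simp: cheb_weight_def prod.distrib)
qed

lemma cheb_weight_boundary:
  "cheb_weight q (Suc b) 0 d = 0" "d > 0 \<Longrightarrow> cheb_weight q 0 a d = q ^ (a * d)"
  by (simp_all add: cheb_weight_small) (simp add: cheb_weight_def)

text \<open>
  The coefficient of $y^{a+1}$ in the recurrence $X U_k = U_{k+1} + y U_{k-1}$, up to the sign
  $(-1)^k$. For $b > 0$ and $a \ge b$ all six weights are a common power of $q$ times a common product
  of $2(b-1)$ factors, times a polynomial in $q$, $q^d$, $q^{a-b}$ and $q^{b-1}$; this leaves a
  polynomial identity. For $a < b$ only weights with $a = b-1$ survive.
\<close>

lemma cheb_weight_rec:
  fixes q :: "'a::comm_ring_1"
  shows "cheb_weight q (Suc b) (Suc a) d - q ^ b * cheb_weight q b (Suc a) d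
      - q ^ Suc b * cheb_weight q b a (Suc d) + (1 - q ^ b)\<^sup>2 * cheb_weight q (b - 1) a (Suc d)
    = - cheb_weight q b (Suc a) (Suc d) - cheb_weight q b a d"
proof (cases b)
  case 0
  (* the weights with d = 0 would be 1 by the formula, but once on each side *)
  show ?thesis
  proof (cases "d = 0")
    case True
    then show ?thesis using 0 by (simp add: cheb_weight_def algebra_simps)
  next
    case False
    then show ?thesis using 0
      by (simp add: cheb_weight_def algebra_simps power_add)
  qed
next
  case (Suc c)
  define P R where "P = (\<Prod>j<c. 1 - q ^ (a - j))" and "R = (\<Prod>j<c. 1 - q ^ (Suc d + j))"
  have falling: "(\<Prod>j<Suc m. 1 - q ^ (Suc a - j)) = (1 - q ^ Suc a) * (\<Prod>j<m. 1 - q ^ (a - j))"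
    for m by (subst prod.lessThan_Suc_shift) simp
  have rising: "(\<Prod>j<Suc m. 1 - q ^ (d + j)) = (1 - q ^ d) * (\<Prod>j<m. 1 - q ^ (Suc d + j))"
    for m by (subst prod.lessThan_Suc_shift) simp
  have last: "(\<Prod>j<Suc c. 1 - q ^ (a - j)) = P * (1 - q ^ (a - c))"
    "(\<Prod>j<Suc c. 1 - q ^ (Suc d + j)) = R * (1 - q ^ (Suc d + c))"
    by (simp_all add: P_def R_def)
  have lower: "cheb_weight q c a (Suc d) = (- 1) ^ c * q ^ ((a - c) * Suc d) * (P * R)"
    by (simp add: cheb_weight_def P_def R_def prod.distrib)
  note weights = cheb_weight_positive_index[OF zero_less_Suc] falling rising last
  consider "a < c" | "a = c" | s where "a = b + s"
    by (metis Suc linorder_cases less_eq_Suc_le le_Suc_ex)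
  then show ?thesis
  proof cases
    case 1
    then show ?thesis using Suc by (simp add: cheb_weight_small)
  next
    case 2
    have "- (q ^ b * cheb_weight q b (Suc a) d) + (1 - q ^ b)\<^sup>2 * cheb_weight q c a (Suc d)
        = - cheb_weight q b (Suc a) (Suc d)"
      unfolding Suc lower weights P_def[symmetric] R_def[symmetric]
      by (simp add: 2 power_add power2_eq_square algebra_simps)
    then show ?thesis using 2 Suc by (simp add: cheb_weight_small)
  next
    case (3 s)
    (* z collects what the six weights share; the powers of q that are left are treated as unknowns *)
    define z where "z = (- 1) ^ c * q ^ (s * d) * (P * R)"
    define t u v where "t = q ^ d" and "u = q ^ s" and "v = q ^ c"
    have top: "cheb_weight q (Suc b) (Suc a) d
        = z * (1 - q * q * u * v) * (1 - q * u) * ((1 - t) * (1 - q * t * v))"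
      unfolding Suc weights P_def[symmetric] R_def[symmetric]
      by (simp add: 3 Suc z_def t_def u_def v_def power_add mult_ac)
    have mid: "cheb_weight q b (Suc a) d = - z * t * (1 - q * q * u * v) * (1 - t)"
      unfolding Suc weights P_def[symmetric] R_def[symmetric]
      by (simp add: 3 Suc z_def t_def u_def v_def power_add mult_ac)
    have low: "cheb_weight q b a (Suc d) = - z * u * (1 - q * u) * (1 - q * t * v)"
      unfolding Suc weights P_def[symmetric] R_def[symmetric]
      by (simp add: 3 Suc z_def t_def u_def v_def power_add mult_ac)
    have bottom: "cheb_weight q (b - 1) a (Suc d) = z * q * t * u"
      unfolding Suc diff_Suc_1 lower
      by (simp add: 3 Suc z_def t_def u_def v_def power_add mult_ac)
    have diag: "cheb_weight q b (Suc a) (Suc d)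
        = - z * q * t * u * (1 - q * q * u * v) * (1 - q * t * v)"
      unfolding Suc weights P_def[symmetric] R_def[symmetric]
      by (simp add: 3 Suc z_def t_def u_def v_def power_add mult_ac)
    have left: "cheb_weight q b a d = - z * (1 - q * u) * (1 - t)"
      unfolding Suc weights P_def[symmetric] R_def[symmetric]
      by (simp add: 3 Suc z_def t_def u_def v_def power_add mult_ac)
    have powers: "q ^ b = q * v" "q ^ Suc b = q * q * v"
      by (simp_all add: Suc v_def)
    show ?thesis
      unfolding top mid low bottom diag left powers by (simp add: power2_eq_square algebra_simps)
  qed
qed

text \<open>
  Adding the zero summand $a = k+1$ and splitting off $a = 0$ aligns the powers of $y$ with those in
  the terms of the recurrence that carry an additional factor $y$.
\<close>

lemma cheb_extend:
  "cheb q y k b = (- 1) ^ k *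
     (cheb_weight q b 0 (Suc k) + y * (\<Sum>a\<le>k. y ^ a * cheb_weight q b (Suc a) (k - a)))"
proof -
  have "(\<Sum>a\<le>k. y ^ a * cheb_weight q b a (Suc k - a))
      = (\<Sum>a\<le>Suc k. y ^ a * cheb_weight q b a (Suc k - a))"
    by (simp add: cheb_weight_def)
  also have "\<dots> = cheb_weight q b 0 (Suc k) + y * (\<Sum>a\<le>k. y ^ a * cheb_weight q b (Suc a) (k - a))"
    by (subst sum.atMost_Suc_shift) (simp add: sum_distrib_left mult.assoc)
  finally show ?thesis by (simp add: cheb_def)
qed

text \<open>The Chebyshev recurrence $J U_k = U_{k+1} + y U_{k-1} + (1+y) U_k$, applied to $\delta$.\<close>

lemma jacobi_cheb:
  "jacobi q y (cheb q y k) b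
     = cheb q y (Suc k) b + (if k = 0 then 0 else y * cheb q y (k - 1) b) + (1 + y) * cheb q y k b"
proof -
  define S where "S f = (\<Sum>a\<le>k. y ^ a * f a (k - a))" for f :: "nat \<Rightarrow> nat \<Rightarrow> 'a"
  let ?w = "cheb_weight q"
  (* here and shifted are the same sequence, indexed for terms with and without a factor y *)
  have here: "cheb q y k b' = (- 1) ^ k * S (\<lambda>a d. ?w b' a (Suc d))" for b'
    by (auto simp: cheb_def S_def Suc_diff_le intro!: sum.cong)
  have shifted: "cheb q y k b' = (- 1) ^ k * (?w b' 0 (Suc k) + y * S (\<lambda>a d. ?w b' (Suc a) d))" for b'
    by (simp add: cheb_extend S_def)
  have up: "cheb q y (Suc k) b
      = - ((- 1) ^ k * (?w b 0 (Suc (Suc k)) + y * S (\<lambda>a d. ?w b (Suc a) (Suc d))))"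
    unfolding cheb_def S_def
    by (subst sum.atMost_Suc_shift)
       (auto simp: sum_distrib_left mult.assoc Suc_diff_le intro!: sum.cong)
  have down: "(if k = 0 then 0 else y * cheb q y (k - 1) b) = - ((- 1) ^ k * (y * S (?w b)))"
    by (cases k) (simp_all add: cheb_def S_def cheb_weight_def)
  have "S (\<lambda>a d. ?w (Suc b) (Suc a) d) - q ^ b * S (\<lambda>a d. ?w b (Suc a) d)
      - q ^ Suc b * S (\<lambda>a d. ?w b a (Suc d)) + (1 - q ^ b)\<^sup>2 * S (\<lambda>a d. ?w (b - 1) a (Suc d))
    = S (\<lambda>a d. ?w (Suc b) (Suc a) d - q ^ b * ?w b (Suc a) d
        - q ^ Suc b * ?w b a (Suc d) + (1 - q ^ b)\<^sup>2 * ?w (b - 1) a (Suc d))"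
    by (simp add: S_def sum_distrib_left sum_subtractf sum.distrib algebra_simps)
  also have "\<dots> = - S (\<lambda>a d. ?w b (Suc a) (Suc d)) - S (?w b)"
    unfolding cheb_weight_rec
    by (simp add: S_def sum_subtractf sum_negf algebra_simps)
  finally have rec: "S (\<lambda>a d. ?w (Suc b) (Suc a) d) = q ^ b * S (\<lambda>a d. ?w b (Suc a) d)
      + q ^ Suc b * S (\<lambda>a d. ?w b a (Suc d)) - (1 - q ^ b)\<^sup>2 * S (\<lambda>a d. ?w (b - 1) a (Suc d))
      - S (\<lambda>a d. ?w b (Suc a) (Suc d)) - S (?w b)"
    by (simp add: algebra_simps)
  have edge: "?w (Suc b) 0 (Suc k) - q ^ b * ?w b 0 (Suc k) = - ?w b 0 (Suc (Suc k))"
    by (cases b) (simp_all add: cheb_weight_boundary)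
  have "jacobi q y (cheb q y k) b - (1 + y) * cheb q y k b
      = cheb q y k (Suc b) - q ^ b * cheb q y k b - y * q ^ Suc b * cheb q y k b
        + y * (1 - q ^ b)\<^sup>2 * cheb q y k (b - 1)"
    by (simp add: jacobi_def algebra_simps)
  also have "\<dots> = (- 1) ^ k * ((?w (Suc b) 0 (Suc k) + y * S (\<lambda>a d. ?w (Suc b) (Suc a) d))
      - q ^ b * (?w b 0 (Suc k) + y * S (\<lambda>a d. ?w b (Suc a) d))
      - y * q ^ Suc b * S (\<lambda>a d. ?w b a (Suc d))
      + y * (1 - q ^ b)\<^sup>2 * S (\<lambda>a d. ?w (b - 1) a (Suc d)))"
    unfolding here[of "b - 1"] shifted[of "Suc b"]
    by (subst (2) here, subst shifted) (simp add: algebra_simps)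
  also have "\<dots> = (- 1) ^ k * ((?w (Suc b) 0 (Suc k) - q ^ b * ?w b 0 (Suc k))
      - y * S (\<lambda>a d. ?w b (Suc a) (Suc d)) - y * S (?w b))"
    unfolding rec by (simp add: algebra_simps)
  also have "\<dots> = cheb q y (Suc k) b + (if k = 0 then 0 else y * cheb q y (k - 1) b)"
    unfolding edge up down by (simp add: algebra_simps)
  finally show ?thesis by (simp add: algebra_simps)
qed

lemma cheb_0: "cheb q y 0 b = (if b = 0 then 1 else 0)"
  by (cases b) (simp_all add: cheb_def cheb_weight_boundary)

text \<open>
  By the Chebyshev recurrence, applying $J$ once more moves weight from $U_k\delta$ to itself and its
  neighbours, as the last step of a ballot path does.
\<close>

lemma jacobi_power_delta:
  "(jacobi q y ^^ n) (\<lambda>b. if b = 0 then 1 else 0) b = (\<Sum>k\<le>n. ballot y n k * cheb q y k b)"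
proof (induction n arbitrary: b)
  case 0
  show ?case by (simp add: ballot_0 cheb_0)
next
  case (Suc n)
  have up: "(\<Sum>k\<le>n. ballot y n k * cheb q y (Suc k) b)
      = (\<Sum>k\<le>Suc n. (if k = 0 then 0 else ballot y n (k - 1)) * cheb q y k b)"
    by (subst sum.atMost_Suc_shift) simp
  have "(\<Sum>k\<le>n. ballot y n k * (if k = 0 then 0 else y * cheb q y (k - 1) b))
      = (\<Sum>k\<le>Suc (Suc n). ballot y n k * (if k = 0 then 0 else y * cheb q y (k - 1) b))"
    by (simp add: ballot_beyond)
  also have "\<dots> = (\<Sum>k\<le>Suc n. y * ballot y n (Suc k) * cheb q y k b)"
    by (subst sum.atMost_Suc_shift) (simp add: algebra_simps del: sum.atMost_Suc)
  finally have down: "(\<Sum>k\<le>n. ballot y n k * (if k = 0 then 0 else y * cheb q y (k - 1) b))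
      = (\<Sum>k\<le>Suc n. y * ballot y n (Suc k) * cheb q y k b)" .
  have level: "(\<Sum>k\<le>n. ballot y n k * ((1 + y) * cheb q y k b))
      = (\<Sum>k\<le>Suc n. (1 + y) * ballot y n k * cheb q y k b)"
    by (simp add: ballot_beyond mult_ac)
  have "(jacobi q y ^^ Suc n) (\<lambda>b. if b = 0 then 1 else 0) b
      = jacobi q y (\<lambda>b. \<Sum>k\<le>n. ballot y n k * cheb q y k b) b"
    by (simp add: Suc[abs_def])
  also have "\<dots> = (\<Sum>k\<le>n. ballot y n k * jacobi q y (cheb q y k) b)"
    by (rule jacobi_sum)
  also have "\<dots> = (\<Sum>k\<le>Suc n. ballot y (Suc n) k * cheb q y k b)"
    unfolding jacobi_cheb distrib_left[of "ballot _ _ _"] sum.distrib up down level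
    by (simp add: ballot_Suc distrib_right sum.distrib del: sum.atMost_Suc)
  finally show ?case .
qed

section \<open>The matrix ansatz in a tridiagonal basis\<close>

text \<open>
  The relations make sense over every field and for every scalar $q$, which keeps the computations
  free of the construction of the rational functions. Linearity of \<open>W\<close> is an assumption
  instead of an imported locale: the module laws of the field over itself would rewrite products in
  the direction opposite to the normal form of \<open>algebra_simps\<close>.
\<close>

locale q_ansatz =
  D: Vector_Spaces.linear scale scale D +
  E: Vector_Spaces.linear scale scale E
  for scale :: "'a::field \<Rightarrow> 'v::ab_group_add \<Rightarrow> 'v" and D E :: "'v \<Rightarrow> 'v"
    and W :: "'v \<Rightarrow> 'a" and V :: 'v +
  fixes q :: 'a
  assumes W_linear: "Vector_Spaces.linear scale (*) W"
    and commutation: "D (E v) - scale q (E (D v)) = D v + E v"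
    and W_E: "W (E v) = W v"
    and D_V: "D V = V"
    and W_V: "W V = 1"
begin

lemma W_hom:
  "W (u + v) = W u + W v" "W (u - v) = W u - W v" "W (scale c v) = c * W v"
  using module_hom.add module_hom.diff module_hom.scale W_linear
  unfolding Vector_Spaces.linear_def by blast+

text \<open>
  With $E' = (1-q)E - 1$, the vector \<open>basis b\<close> is $(E'+q^{b-1}) \cdots (E'+q)(E'+1) V$. The
  nodes $-q^i$ are chosen such that the lowering part of $D$ goes down by a single index.
\<close>

fun basis :: "nat \<Rightarrow> 'v" where
  "basis 0 = V"
| "basis (Suc b) = scale (1 - q) (E (basis b)) - scale (1 - q ^ b) (basis b)"

lemmas vs_scale = D.vs1.scale_right_distrib D.vs1.scale_right_diff_distrib D.vs1.scale_scale

text \<open>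
  By induction: the commutation relation moves $D$ past the $E$ of the last factor, and the
  coefficient of \<open>basis (b - 1)\<close> in $D$ applied to \<open>basis (Suc b)\<close> cancels.
\<close>

lemma D_basis:
  "scale (1 - q) (D (basis b))
     = scale (1 - q ^ Suc b) (basis b) + scale ((1 - q ^ b)\<^sup>2) (basis (b - 1))"
proof (induction b)
  case 0
  show ?case by (simp add: D_V)
next
  case (Suc b)
  (* F is the vector known by induction; E u and E u' are expressed by the basis again *)
  define u u' F where "u = basis b" and "u' = basis (b - 1)" and "F = scale (1 - q) (D u)"
  have F: "F = scale (1 - q ^ Suc b) u + scale ((1 - q ^ b)\<^sup>2) u'"
    using Suc by (simp add: u_def u'_def F_def)
  have E_u: "scale (1 - q) (E u) = basis (Suc b) + scale (1 - q ^ b) u"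
    by (simp add: u_def)
  have E_u': "scale ((1 - q ^ b)\<^sup>2 * q * (1 - q)) (E u')
      = scale ((1 - q ^ b)\<^sup>2 * q) u + scale ((1 - q ^ b)\<^sup>2 * (q - q ^ b)) u'"
  proof (cases b)
    case (Suc c)
    have "scale (1 - q) (E u') = u + scale (1 - q ^ c) u'"
      by (simp add: u_def u'_def Suc)
    then have "scale ((1 - q ^ b)\<^sup>2 * q) (scale (1 - q) (E u'))
        = scale ((1 - q ^ b)\<^sup>2 * q) u + scale ((1 - q ^ b)\<^sup>2 * q * (1 - q ^ c)) u'"
      by (simp only: vs_scale)
    moreover have "(1 - q ^ b)\<^sup>2 * q * (1 - q ^ c) = (1 - q ^ b)\<^sup>2 * (q - q ^ b)"
      by (simp add: Suc algebra_simps)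
    ultimately show ?thesis by (simp only: D.vs1.scale_scale)
  qed simp
  have DE: "D (E u) = scale q (E (D u)) + (D u + E u)"
    using commutation[of u] by (simp add: algebra_simps)
  have "scale (1 - q) (D (basis (Suc b)))
      = scale ((1 - q) * (1 - q)) (D (E u)) - scale (1 - q ^ b) F"
    by (simp add: u_def F_def D.diff D.scale vs_scale mult.commute del: mult_cancel_left)
  also have "\<dots> = scale (q * (1 - q)) (E F) + (scale (1 - q) F - scale (1 - q ^ b) F)
      + scale (1 - q) (scale (1 - q) (E u))"
    unfolding DE by (simp add: F_def E.scale vs_scale mult_ac)
  also have "\<dots> = scale (q * (1 - q)) (E F) + scale (q ^ b - q) F
      + scale (1 - q) (scale (1 - q) (E u))"
    by (simp flip: D.vs1.scale_left_diff_distrib)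
  also have "\<dots> = scale (q * (1 - q ^ Suc b)) (scale (1 - q) (E u))
      + scale ((1 - q ^ b)\<^sup>2 * q * (1 - q)) (E u')
      + scale (q ^ b - q) F + scale (1 - q) (scale (1 - q) (E u))"
    by (simp add: F E.add E.scale vs_scale mult_ac)
  also have "\<dots> = scale (q * (1 - q ^ Suc b) + (1 - q)) (basis (Suc b))
      + scale ((q * (1 - q ^ Suc b) + (1 - q)) * (1 - q ^ b) + (1 - q ^ b)\<^sup>2 * q
          + (q ^ b - q) * (1 - q ^ Suc b)) u
      + scale ((1 - q ^ b)\<^sup>2 * (q - q ^ b) + (q ^ b - q) * (1 - q ^ b)\<^sup>2) u'"
    unfolding E_u E_u' F
    by (simp add: vs_scale D.vs1.scale_left_distrib distrib_right del: basis.simps power_Suc)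
  also have "q * (1 - q ^ Suc b) + (1 - q) = 1 - q ^ Suc (Suc b)"
    by (simp add: algebra_simps)
  also have "(1 - q ^ Suc (Suc b)) * (1 - q ^ b) + (1 - q ^ b)\<^sup>2 * q
      + (q ^ b - q) * (1 - q ^ Suc b) = (1 - q ^ Suc b)\<^sup>2"
    by (simp add: power2_eq_square algebra_simps)
  also have "(1 - q ^ b)\<^sup>2 * (q - q ^ b) + (q ^ b - q) * (1 - q ^ b)\<^sup>2 = 0"
    by (simp add: algebra_simps)
  finally show ?case by (simp add: u_def del: basis.simps)
qed

lemma step_basis:
  "scale (1 - q) (scale y (D (basis b)) + E (basis b))
    = basis (Suc b) + scale (1 + y - (1 + y * q) * q ^ b) (basis b)
      + scale (y * (1 - q ^ b)\<^sup>2) (basis (b - 1))"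
proof -
  have "scale (1 - q) (scale y (D (basis b)) + E (basis b))
      = scale y (scale (1 - q) (D (basis b))) + scale (1 - q) (E (basis b))"
    by (simp add: D.vs1.scale_right_distrib mult.commute)
  also have "scale (1 - q) (E (basis b)) = basis (Suc b) + scale (1 - q ^ b) (basis b)"
    by simp
  also have "scale y (scale (1 - q) (D (basis b))) + (basis (Suc b) + scale (1 - q ^ b) (basis b))
      = basis (Suc b) + scale (y * (1 - q ^ Suc b) + (1 - q ^ b)) (basis b)
        + scale (y * (1 - q ^ b)\<^sup>2) (basis (b - 1))"
    by (simp add: D_basis vs_scale D.vs1.scale_left_distrib del: basis.simps power_Suc)
  also have "y * (1 - q ^ Suc b) + (1 - q ^ b) = 1 + y - (1 + y * q) * q ^ b"
    by (simp add: algebra_simps)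
  finally show ?thesis .
qed

abbreviation step :: "'a \<Rightarrow> 'v \<Rightarrow> 'v" where "step y v \<equiv> scale y (D v) + E v"

lemma step_power_add: "(step y ^^ n) (u + v) = (step y ^^ n) u + (step y ^^ n) v"
  by (induction n) (simp_all add: D.add E.add vs_scale)

lemma step_power_scale: "(step y ^^ n) (scale c v) = scale c ((step y ^^ n) v)"
  by (induction n) (simp_all add: D.scale E.scale vs_scale mult.commute)

text \<open>The factor $q - q$ at $b = 1$ makes \<open>W\<close> vanish on all basis vectors of index at least $2$.\<close>

lemma W_basis_Suc: "W (basis (Suc b)) = (q ^ b - q) * W (basis b)"
  by (simp only: basis.simps W_hom W_E) (simp add: algebra_simps)

lemma W_power_basis:
  "(1 - q) ^ n * W ((step y ^^ n) (basis b)) = (jacobi q y ^^ n) (\<lambda>b. W (basis b)) b"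
proof (induction n arbitrary: b)
  case (Suc n)
  have "(1 - q) ^ Suc n * W ((step y ^^ Suc n) (basis b))
      = (1 - q) ^ n * W ((step y ^^ n) (scale (1 - q) (step y (basis b))))"
    unfolding step_power_scale W_hom by (simp add: funpow_Suc_right mult_ac del: funpow.simps)
  also have "\<dots> = jacobi q y (\<lambda>b. (1 - q) ^ n * W ((step y ^^ n) (basis b))) b"
    unfolding step_basis step_power_add step_power_scale W_hom
    by (simp add: jacobi_def algebra_simps del: basis.simps)
  finally show ?case by (simp add: Suc)
qed simp

text \<open>
  The two sequences agree at $0$ and $1$ by computation, and vanish from $2$ on. This is the identity
  $W'(yD+E) = yW$ for a functional $W'$ with $W'E = 0$, expressed without assuming that such a
  functional exists on the given space.
\<close>

lemma jacobi_delta: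
  "jacobi q y (\<lambda>b. if b = 0 then 1 else 0) = (\<lambda>b. y * (1 - q) * W (basis b))"
proof
  fix b
  have vanish: "W (basis (Suc (Suc c))) = 0" for c
    by (induction c) (simp_all add: W_basis_Suc del: basis.simps)
  consider "b = 0" | "b = Suc 0" | c where "b = Suc (Suc c)"
    using not0_implies_Suc by blast
  then show "jacobi q y (\<lambda>b. if b = 0 then 1 else 0) b
      = y * (1 - q) * W (basis b)"
  proof cases
    case 1
    then show ?thesis by (simp add: jacobi_def W_V algebra_simps)
  next
    case 2
    have "W (basis (Suc 0)) = 1 - q" by (simp only: W_basis_Suc) (simp add: W_V)
    then show ?thesis using 2 by (simp add: jacobi_def power2_eq_square del: basis.simps)
  next
    case 3
    then show ?thesis by (simp add: jacobi_def vanish del: basis.simps)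
  qed
qed

text \<open>
  Replacing \<open>W\<close> by $\delta$ turns $n-1$ applications of $J$ into $n$ and produces the
  factor $y(1-q)$.
\<close>

lemma moment_formula:
  assumes "n > 0"
  shows "y * (1 - q) ^ n * W ((step y ^^ (n - 1)) V)
    = (\<Sum>k\<le>n. ballot y n k * cheb q y k 0)"
proof -
  obtain m where n: "n = Suc m" using assms not0_implies_Suc by blast
  let ?J = "jacobi q y"
  have "(\<Sum>k\<le>n. ballot y n k * cheb q y k 0) = (?J ^^ m) (?J (\<lambda>b. if b = 0 then 1 else 0)) 0"
    unfolding jacobi_power_delta[symmetric] n by (simp only: funpow_Suc_right o_def)
  also have "\<dots> = y * (1 - q) * (?J ^^ m) (\<lambda>b. W (basis b)) 0"
    by (simp only: jacobi_delta jacobi_power_scale)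
  also have "\<dots> = y * (1 - q) * ((1 - q) ^ m * W ((step y ^^ m) (basis 0)))"
    by (simp only: W_power_basis)
  finally show ?thesis by (simp add: n mult_ac)
qed

end

section \<open>The explicit formula\<close>

lemma y_ind_neq_0: "y_ind \<noteq> 0"
  by (simp add: y_ind_def Zero_fract_def eq_fract)

lemma cheb_at_0: "cheb q y k 0 = (- 1) ^ k * (\<Sum>a=0..k. y ^ a * q ^ (a * (k + 1 - a)))"
  by (auto simp: cheb_def cheb_weight_boundary atMost_atLeast0 intro!: sum.cong)

theorem theorem1:
  fixes scale :: "scalar \<Rightarrow> 'v::ab_group_add \<Rightarrow> 'v"
    and D E :: "'v \<Rightarrow> 'v" and W :: "'v \<Rightarrow> scalar" and V :: 'v and n :: nat
  assumes "matrix_ansatz scale D E W V" and "n > 0"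
  shows "W (((\<lambda>v. scale y_ind (D v) + E v) ^^ (n - 1)) V) =
    1 / (y_ind * (1 - q_ind) ^ n) *
    (\<Sum>k=0..n. (- 1) ^ k *
       (\<Sum>j=0..n - k. y_ind ^ j *
          of_int (binom n (int j) * binom n (int j + int k)
                  - binom n (int j - 1) * binom n (int j + int k + 1))) *
       (\<Sum>i=0..k. y_ind ^ i * q_ind ^ (i * (k + 1 - i))))"
proof -
  have "(\<Sum>k\<le>n. ballot y_ind n k * cheb q_ind y_ind k 0)
    = (\<Sum>k=0..n. (- 1) ^ k *
       (\<Sum>j=0..n - k. y_ind ^ j *
          of_int (binom n (int j) * binom n (int j + int k)
                  - binom n (int j - 1) * binom n (int j + int k + 1))) *
       (\<Sum>i=0..k. y_ind ^ i * q_ind ^ (i * (k + 1 - i))))"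
    unfolding cheb_at_0 ballot_def ballot_coeff_def atMost_atLeast0 by (simp only: mult_ac)
  moreover have "y_ind * (1 - q_ind) ^ n \<noteq> 0"
    using y_ind_neq_0 q_ind_neq_1 by simp
  moreover have "q_ansatz scale D E W V q_ind"
    using assms(1)
    by (simp add: q_ansatz_def q_ansatz_axioms_def matrix_ansatz_def matrix_ansatz_axioms_def)
  ultimately show ?thesis
    using q_ansatz.moment_formula[of scale D E W V q_ind n y_ind] \<open>n > 0\<close> by (simp add: field_simps)
qed

end
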